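(* For every $k\geq1$, the Boolean algebra of languages $\mathcal B\Sigma_1[\mathcal N^u_k]$ is equal to $\mathcal B_k$.
   Context: $A$ is a finite alphabet. A $k$-ary uniform numerical predicate is given by a subset $P\subseteq\mathbb N^k$; a structure $(w,\bar i)$ (a word $w\in A^*$ with positions $\bar i$ marked, all $<|w|$) satisfies it iff $\bar i\in P$. Letter predicates $a(x)$ hold iff the letter at position $x$ is $a$. $\mathcal B\Sigma_1[\mathcal N^u_k]$ is the Boolean algebra of languages $\{w\in A^*: w\models\varphi\}$ defined by Boolean combinations $\varphi$ of sentences of the form $\exists x_1\dots\exists x_m\,\psi$ with $m\leq k$ and $\psi$ quantifier-free, built from letter predicates and uniform numerical predicates of arity $l\in\{1,\dots,k\}$. For $k\geq1$, $\bar a\in A^k$, $w\in A^*$: $c_{\bar a}(w):=\{\bar i\in\mathbb N^k: i_j<|w| \text{ and } w_{i_j}=a_j\text{ for all }j\}$; for $Q\subseteq\mathbb N^k$, $L_{\Diamond^{\bar a}_Q}:=\{w: c_{\bar a}(w)\cap Q\neq\emptyset\}$; $\mathcal B_k$ is the Boolean subalgebra of $\mathcal P(A^* )$ generated by all $L_{\Diamond^{\bar a}_Q}$. *)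

theory Defs
  imports "HOL-Analysis.Sigma_Algebra"
begin

text \<open>Tuples of natural numbers are lists of the appropriate length; positions in a word
  and components of a tuple are counted from 0.\<close>

definition tuples :: "nat \<Rightarrow> nat list set" where
  "tuples l = {is. length is = l}"

datatype (atoms: 'p) bool_comb =
    Atom 'p
  | Tru
  | Neg "'p bool_comb"
  | Conj "'p bool_comb" "'p bool_comb"
  | Disj "'p bool_comb" "'p bool_comb"

primrec holds :: "('p \<Rightarrow> bool) \<Rightarrow> 'p bool_comb \<Rightarrow> bool" where
  "holds v (Atom p) = v p"
| "holds v Tru = True"
| "holds v (Neg \<phi>) = (\<not> holds v \<phi>)"
| "holds v (Conj \<phi> \<psi>) = (holds v \<phi> \<and> holds v \<psi>)"
| "holds v (Disj \<phi> \<psi>) = (holds v \<phi> \<or> holds v \<psi>)"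

text \<open>First-order variables are natural numbers. \<open>Num P xs\<close> applies the uniform numerical
  predicate given by the set \<open>P\<close>, of arity \<open>length xs\<close>, to the variables \<open>xs\<close>;
  \<open>Exists m \<psi>\<close> quantifies the variables \<open>0, \<dots>, m - 1\<close>.\<close>

datatype 'a atomic = Letter 'a nat | Num "nat list set" "nat list"

type_synonym 'a qf = "'a atomic bool_comb"

datatype 'a ex_sentence = Exists nat "'a qf"

primrec wf_atomic :: "'a set \<Rightarrow> nat \<Rightarrow> nat \<Rightarrow> 'a atomic \<Rightarrow> bool" where
  "wf_atomic A k m (Letter a x) \<longleftrightarrow> a \<in> A \<and> x < m"
| "wf_atomic A k m (Num P xs) \<longleftrightarrow>
     length xs \<in> {1..k} \<and> P \<subseteq> tuples (length xs) \<and> set xs \<subseteq> {..<m}"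

primrec wf_ex_sentence :: "'a set \<Rightarrow> nat \<Rightarrow> 'a ex_sentence \<Rightarrow> bool" where
  "wf_ex_sentence A k (Exists m \<psi>) \<longleftrightarrow> m \<le> k \<and> (\<forall>p\<in>atoms \<psi>. wf_atomic A k m p)"

text \<open>In the structure \<open>(w, is)\<close> the variable \<open>x\<close> denotes the marked position \<open>is ! x\<close>.\<close>

primrec sat_atomic :: "'a list \<Rightarrow> nat list \<Rightarrow> 'a atomic \<Rightarrow> bool" where
  "sat_atomic w is (Letter a x) \<longleftrightarrow> w ! (is ! x) = a"
| "sat_atomic w is (Num P xs) \<longleftrightarrow> map (\<lambda>x. is ! x) xs \<in> P"

primrec sat_ex_sentence :: "'a list \<Rightarrow> 'a ex_sentence \<Rightarrow> bool" where
  "sat_ex_sentence w (Exists m \<psi>) \<longleftrightarrow>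
     (\<exists>is\<in>tuples m. set is \<subseteq> {..<length w} \<and> holds (sat_atomic w is) \<psi>)"

definition BSigma1 :: "'a set \<Rightarrow> nat \<Rightarrow> 'a list set set" where
  "BSigma1 A k =
     {{w \<in> lists A. holds (sat_ex_sentence w) \<phi>} | \<phi>. \<forall>s\<in>atoms \<phi>. wf_ex_sentence A k s}"

definition content :: "'a list \<Rightarrow> 'a list \<Rightarrow> nat list set" where
  "content as w =
     {is \<in> tuples (length as). \<forall>j<length as. is ! j < length w \<and> w ! (is ! j) = as ! j}"

definition L_diamond :: "'a set \<Rightarrow> 'a list \<Rightarrow> nat list set \<Rightarrow> 'a list set" where
  "L_diamond A as Q = {w \<in> lists A. content as w \<inter> Q \<noteq> {}}"

definition B_alg :: "'a set \<Rightarrow> nat \<Rightarrow> 'a list set set" where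
  "B_alg A k = algebra (lists A) hull
     {L_diamond A as Q | as Q. as \<in> lists A \<and> length as = k \<and> Q \<subseteq> tuples k}"

end

theory Submission imports Defs begin

text \<open>Whether a quantifier-free formula holds at a tuple of positions depends only on that tuple
  and on the letters read there. Splitting an existential sentence with exactly \<open>k\<close> quantifiers
  according to the finitely many tuples of letters therefore writes its language as a finite
  union of languages \<open>L_diamond\<close>; a sentence with fewer quantifiers, but at least one, is first
  padded with vacuous ones. Conversely, \<open>L_diamond\<close> is itself defined by an existential sentence
  with \<open>k\<close> quantifiers, so each of the two algebras contains the generators of the other.\<close>

lemma holds_cong:
  "(\<And>p. p \<in> atoms \<phi> \<Longrightarrow> u p = v p) \<Longrightarrow> holds u \<phi> = holds v \<phi>"
  by (induction \<phi>) auto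

lemma holds_foldr_Conj:
  "holds v (foldr Conj \<phi>s \<phi>) \<longleftrightarrow> (\<forall>\<psi>\<in>set \<phi>s. holds v \<psi>) \<and> holds v \<phi>"
  by (induction \<phi>s) auto

lemma atoms_foldr_Conj:
  "atoms (foldr Conj \<phi>s \<phi>) = (\<Union>\<psi>\<in>set \<phi>s. atoms \<psi>) \<union> atoms \<phi>"
  by (induction \<phi>s) auto

lemma algebra_Collect_holds:
  "algebra S {{x \<in> S. holds (v x) \<phi>} | \<phi>. atoms \<phi> \<subseteq> P}" (is "algebra S ?C")
  unfolding algebra_iff_Un
proof (intro conjI ballI)
  show "?C \<subseteq> Pow S"
    by auto
  show "{} \<in> ?C"
    by (intro CollectI exI[of _ "Neg Tru"]) simp
next
  fix X assume "X \<in> ?C"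
  then obtain \<phi> where "X = {x \<in> S. holds (v x) \<phi>}" "atoms \<phi> \<subseteq> P"
    by blast
  then show "S - X \<in> ?C"
    by (intro CollectI exI[of _ "Neg \<phi>"]) auto
next
  fix X Y assume "X \<in> ?C" "Y \<in> ?C"
  then obtain \<phi> \<psi> where "X = {x \<in> S. holds (v x) \<phi>}" "atoms \<phi> \<subseteq> P"
    "Y = {x \<in> S. holds (v x) \<psi>}" "atoms \<psi> \<subseteq> P"
    by blast
  then show "X \<union> Y \<in> ?C"
    by (intro CollectI exI[of _ "Disj \<phi> \<psi>"]) auto
qed

lemma (in algebra) sets_Collect_holds:
  assumes "\<And>p. p \<in> atoms \<phi> \<Longrightarrow> {x \<in> \<Omega>. v x p} \<in> M"
  shows "{x \<in> \<Omega>. holds (v x) \<phi>} \<in> M"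
  using assms
  by (induction \<phi>) (auto intro: sets_Collect_neg sets_Collect_conj sets_Collect_disj)

lemma algebra_hull_eq_Collect_holds:
  "algebra S hull {{x \<in> S. v x p} | p. p \<in> P} =
    {{x \<in> S. holds (v x) \<phi>} | \<phi>. atoms \<phi> \<subseteq> P}" (is "_ hull ?G = ?C")
proof (rule hull_unique)
  show "?G \<subseteq> ?C"
  proof
    fix X assume "X \<in> ?G"
    then obtain p where "X = {x \<in> S. v x p}" "p \<in> P"
      by blast
    then show "X \<in> ?C"
      by (intro CollectI exI[of _ "Atom p"]) simp
  qed
  show "algebra S ?C"
    by (rule algebra_Collect_holds)
next
  fix M assume "?G \<subseteq> M" "algebra S M"
  interpret algebra S M by fact
  show "?C \<subseteq> M"
  proof
    fix X assume "X \<in> ?C"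
    then obtain \<phi> where "X = {x \<in> S. holds (v x) \<phi>}" "atoms \<phi> \<subseteq> P"
      by blast
    with \<open>?G \<subseteq> M\<close> show "X \<in> M"
      using sets_Collect_holds[of \<phi> v] by blast
  qed
qed

lemma algebra_algebra_hull:
  assumes "G \<subseteq> Pow S"
  shows "algebra S (algebra S hull G)"
proof -
  have "{x \<in> S. x \<in> X} = X" if "X \<in> G" for X
    using that assms by blast
  then have "{{x \<in> S. x \<in> X} | X. X \<in> G} = G"
    unfolding Setcompr_eq_image by simp
  then show ?thesis
    using algebra_hull_eq_Collect_holds[of S "(\<in>)" G] algebra_Collect_holds[of S "(\<in>)" G]
    by metis
qed

definition ex_lang :: "'a set \<Rightarrow> 'a ex_sentence \<Rightarrow> 'a list set" where
  "ex_lang A s = {w \<in> lists A. sat_ex_sentence w s}"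

definition ex_langs :: "'a set \<Rightarrow> nat \<Rightarrow> 'a list set set" where
  "ex_langs A k = {ex_lang A s | s. wf_ex_sentence A k s}"

lemma BSigma1_eq_algebra_hull: "BSigma1 A k = algebra (lists A) hull ex_langs A k"
  using algebra_hull_eq_Collect_holds[of "lists A" sat_ex_sentence "Collect (wf_ex_sentence A k)"]
  by (simp add: BSigma1_def ex_langs_def ex_lang_def subset_eq)

lemma wf_atomic_mono: "wf_atomic A k m p \<Longrightarrow> m \<le> n \<Longrightarrow> wf_atomic A k n p"
  by (cases p) auto

lemma holds_sat_atomic_cong:
  assumes wf: "\<forall>p\<in>atoms \<psi>. wf_atomic A k m p"
    and positions: "\<And>x. x < m \<Longrightarrow> ps ! x = qs ! x"
    and letters: "\<And>x. x < m \<Longrightarrow> v ! (ps ! x) = w ! (ps ! x)"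
  shows "holds (sat_atomic v ps) \<psi> \<longleftrightarrow> holds (sat_atomic w qs) \<psi>"
proof (rule holds_cong)
  fix p assume "p \<in> atoms \<psi>"
  with wf have "wf_atomic A k m p"
    by blast
  then show "sat_atomic v ps p = sat_atomic w qs p"
  proof (cases p)
    case (Letter a x)
    with \<open>wf_atomic A k m p\<close> show ?thesis
      using positions letters by auto
  next
    case (Num P xs)
    with \<open>wf_atomic A k m p\<close> have "map ((!) ps) xs = map ((!) qs) xs"
      using positions by auto
    with Num show ?thesis
      by (simp del: map_eq_conv)
  qed
qed

lemma sat_ex_sentence_Exists_0_cong:
  assumes "\<forall>p\<in>atoms \<psi>. wf_atomic A k 0 p"
  shows "sat_ex_sentence v (Exists 0 \<psi>) \<longleftrightarrow> sat_ex_sentence w (Exists 0 \<psi>)"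
  using holds_sat_atomic_cong[OF assms, of "[]" "[]" v w] by (simp add: tuples_def)

lemma sat_ex_sentence_Exists_pad:
  assumes wf: "\<forall>p\<in>atoms \<psi>. wf_atomic A k m p" and "1 \<le> m" "m \<le> n"
  shows "sat_ex_sentence w (Exists m \<psi>) \<longleftrightarrow> sat_ex_sentence w (Exists n \<psi>)"
proof
  assume "sat_ex_sentence w (Exists m \<psi>)"
  then obtain ps where ps: "length ps = m" "set ps \<subseteq> {..<length w}" "holds (sat_atomic w ps) \<psi>"
    by (auto simp: tuples_def)
  define qs where "qs = ps @ replicate (n - m) (hd ps)"
  have "hd ps \<in> set ps"
    using ps(1) \<open>1 \<le> m\<close> by (intro hd_in_set) auto
  then have "qs \<in> tuples n" "set qs \<subseteq> {..<length w}"
    using ps \<open>m \<le> n\<close> by (auto simp: qs_def tuples_def)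
  moreover have "holds (sat_atomic w qs) \<psi>"
    using ps holds_sat_atomic_cong[OF wf, of ps qs w w] by (simp add: qs_def nth_append)
  ultimately show "sat_ex_sentence w (Exists n \<psi>)"
    by auto
next
  assume "sat_ex_sentence w (Exists n \<psi>)"
  then obtain qs where qs: "length qs = n" "set qs \<subseteq> {..<length w}" "holds (sat_atomic w qs) \<psi>"
    by (auto simp: tuples_def)
  have "take m qs \<in> tuples m" "set (take m qs) \<subseteq> {..<length w}"
    using qs \<open>m \<le> n\<close> set_take_subset[of m qs] by (auto simp: tuples_def)
  moreover have "holds (sat_atomic w (take m qs)) \<psi>"
    using qs holds_sat_atomic_cong[OF wf, of "take m qs" qs w w] by simp
  ultimately show "sat_ex_sentence w (Exists m \<psi>)"
    by auto
qed

definition diamonds :: "'a set \<Rightarrow> nat \<Rightarrow> 'a list set set" where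
  "diamonds A k = {L_diamond A as Q | as Q. as \<in> lists A \<and> length as = k \<and> Q \<subseteq> tuples k}"

lemma diamonds_subset_Pow: "diamonds A k \<subseteq> Pow (lists A)"
  by (auto simp: diamonds_def L_diamond_def)

definition diamond_sentence :: "'a list \<Rightarrow> nat list set \<Rightarrow> 'a ex_sentence" where
  "diamond_sentence as Q = Exists (length as)
    (foldr Conj (map (\<lambda>j. Atom (Letter (as ! j) j)) [0..<length as])
      (Atom (Num Q [0..<length as])))"

lemma wf_diamond_sentence:
  assumes "as \<in> lists A" "1 \<le> length as" "Q \<subseteq> tuples (length as)"
  shows "wf_ex_sentence A (length as) (diamond_sentence as Q)"
  using assms by (auto simp: diamond_sentence_def atoms_foldr_Conj)

lemma sat_diamond_sentence_iff:
  "sat_ex_sentence w (diamond_sentence as Q) \<longleftrightarrow> content as w \<inter> Q \<noteq> {}"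
proof -
  have "map ((!) ps) [0..<length as] = ps" if "length ps = length as" for ps :: "nat list"
    using that map_nth[of ps] by simp
  then show ?thesis
    by (auto simp: diamond_sentence_def holds_foldr_Conj content_def tuples_def
        subset_eq all_set_conv_all_nth)
qed

lemma diamonds_subset_ex_langs:
  assumes "1 \<le> k"
  shows "diamonds A k \<subseteq> ex_langs A k"
proof
  fix X assume "X \<in> diamonds A k"
  then obtain as Q where X: "X = L_diamond A as Q"
    and as: "as \<in> lists A" "length as = k" and Q: "Q \<subseteq> tuples k"
    by (auto simp: diamonds_def)
  have "X = ex_lang A (diamond_sentence as Q)"
    by (simp add: X L_diamond_def ex_lang_def sat_diamond_sentence_iff)
  moreover have "wf_ex_sentence A k (diamond_sentence as Q)"
    using wf_diamond_sentence[of as A Q] as Q assms by auto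
  ultimately show "X \<in> ex_langs A k"
    by (auto simp: ex_langs_def)
qed

definition satisfying_tuples :: "'a qf \<Rightarrow> 'a list \<Rightarrow> nat list set" where
  "satisfying_tuples \<psi> as = {ps. \<exists>w. ps \<in> content as w \<and> holds (sat_atomic w ps) \<psi>}"

lemma satisfying_tuples_subset: "satisfying_tuples \<psi> as \<subseteq> tuples (length as)"
  by (auto simp: satisfying_tuples_def content_def)

lemma mem_satisfying_tuples_iff:
  assumes wf: "\<forall>p\<in>atoms \<psi>. wf_atomic A k (length as) p" and "ps \<in> content as w"
  shows "ps \<in> satisfying_tuples \<psi> as \<longleftrightarrow> holds (sat_atomic w ps) \<psi>"
proof -
  have "holds (sat_atomic v ps) \<psi> \<longleftrightarrow> holds (sat_atomic w ps) \<psi>" if "ps \<in> content as v" for v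
    using that assms(2) by (intro holds_sat_atomic_cong[OF wf]) (auto simp: content_def)
  with assms(2) show ?thesis
    unfolding satisfying_tuples_def by blast
qed

lemma UN_content:
  assumes "w \<in> lists A"
  shows "(\<Union>as\<in>{as \<in> lists A. length as = m}. content as w) =
    {ps \<in> tuples m. set ps \<subseteq> {..<length w}}"
proof -
  have content_iff: "ps \<in> content as w \<longleftrightarrow> set ps \<subseteq> {..<length w} \<and> map ((!) w) ps = as" for as ps
    unfolding content_def tuples_def list_eq_iff_nth_eq subset_eq all_set_conv_all_nth by auto
  have "map ((!) w) ps \<in> lists A" if "set ps \<subseteq> {..<length w}" for ps
    using that assms by (auto simp: lists_eq_set subset_iff)
  then show ?thesis
    by (auto simp: content_iff tuples_def)
qed

lemma ex_lang_eq_UN_L_diamond: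
  assumes wf: "\<forall>p\<in>atoms \<psi>. wf_atomic A k m p"
  shows "ex_lang A (Exists m \<psi>) =
    (\<Union>as\<in>{as \<in> lists A. length as = m}. L_diamond A as (satisfying_tuples \<psi> as))"
proof -
  have "sat_ex_sentence w (Exists m \<psi>) \<longleftrightarrow>
      (\<exists>as\<in>lists A. length as = m \<and> content as w \<inter> satisfying_tuples \<psi> as \<noteq> {})"
    if "w \<in> lists A" for w
  proof -
    have "sat_ex_sentence w (Exists m \<psi>) \<longleftrightarrow>
        (\<exists>ps\<in>{ps \<in> tuples m. set ps \<subseteq> {..<length w}}. holds (sat_atomic w ps) \<psi>)"
      by auto
    also have "\<dots> \<longleftrightarrow>
        (\<exists>as\<in>lists A. length as = m \<and> (\<exists>ps\<in>content as w. holds (sat_atomic w ps) \<psi>))"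
      unfolding UN_content[OF that, symmetric] by blast
    also have "\<dots> \<longleftrightarrow>
        (\<exists>as\<in>lists A. length as = m \<and> content as w \<inter> satisfying_tuples \<psi> as \<noteq> {})"
      using wf mem_satisfying_tuples_iff by blast
    finally show ?thesis .
  qed
  then show ?thesis
    unfolding ex_lang_def L_diamond_def by blast
qed

lemma ex_langs_subset_algebra_hull_diamonds:
  assumes "finite A"
  shows "ex_langs A k \<subseteq> algebra (lists A) hull diamonds A k" (is "_ \<subseteq> ?M")
proof
  interpret algebra "lists A" ?M
    by (rule algebra_algebra_hull[OF diamonds_subset_Pow])
  fix X assume "X \<in> ex_langs A k"
  then obtain s where X: "X = ex_lang A s" and "wf_ex_sentence A k s"
    by (auto simp: ex_langs_def)
  moreover obtain m \<psi> where s: "s = Exists m \<psi>"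
    by (cases s)
  ultimately have "m \<le> k" and wf: "\<forall>p\<in>atoms \<psi>. wf_atomic A k m p"
    by auto
  show "X \<in> ?M"
  proof (cases "m = 0")
    case True
    \<comment> \<open>Padding is impossible here: the empty word may satisfy the sentence.\<close>
    with wf have "X = {w \<in> lists A. sat_ex_sentence [] s}"
      unfolding X s ex_lang_def using sat_ex_sentence_Exists_0_cong by blast
    then show ?thesis
      using sets_Collect_const by simp
  next
    case False
    then have "X = ex_lang A (Exists k \<psi>)"
      using sat_ex_sentence_Exists_pad[OF wf _ \<open>m \<le> k\<close>]
      by (simp add: X s ex_lang_def del: sat_ex_sentence.simps)
    also have "\<dots> = (\<Union>as\<in>{as \<in> lists A. length as = k}. L_diamond A as (satisfying_tuples \<psi> as))"
      using wf wf_atomic_mono \<open>m \<le> k\<close> by (intro ex_lang_eq_UN_L_diamond) blast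
    also have "\<dots> \<in> ?M"
    proof (rule finite_UN)
      show "finite {as \<in> lists A. length as = k}"
        using finite_lists_length_eq[OF assms, of k] by (simp add: lists_eq_set)
      fix as assume "as \<in> {as \<in> lists A. length as = k}"
      then have "L_diamond A as (satisfying_tuples \<psi> as) \<in> diamonds A k"
        using satisfying_tuples_subset[of \<psi> as] unfolding diamonds_def by blast
      then show "L_diamond A as (satisfying_tuples \<psi> as) \<in> ?M"
        by (rule hull_inc)
    qed
    finally show ?thesis .
  qed
qed

theorem mainTheorem3:
  fixes A :: "'a set" and k :: nat
  assumes "finite A" and "k \<ge> 1"
  shows "BSigma1 A k = B_alg A k"
  unfolding BSigma1_eq_algebra_hull B_alg_def diamonds_def[symmetric]
proof
  show "algebra (lists A) hull ex_langs A k \<subseteq> algebra (lists A) hull diamonds A k"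
    using ex_langs_subset_algebra_hull_diamonds[OF \<open>finite A\<close>]
      algebra_algebra_hull[OF diamonds_subset_Pow]
    by (rule hull_minimal)
  show "algebra (lists A) hull diamonds A k \<subseteq> algebra (lists A) hull ex_langs A k"
    using diamonds_subset_ex_langs[OF \<open>k \<ge> 1\<close>] by (rule hull_mono)
qed

end
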